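(* For all integers $n\ge 4$ and $k\ge 2$, $r_o(M_k,P_n)\le n+2k-4$. Moreover, if in addition $n\ge 3k-3$, then $r_o(M_k,P_n)=n+2k-4$.
   Context: An ordered graph is a graph with a linear ordering on its vertices; subgraphs inherit the ordering, and copies are taken via order-preserving isomorphisms. The ordered path $P_n$ has vertices $v_1<\dots<v_n$ and edges $v_iv_{i+1}$. The serial $k$-edge matching $M_k$ is the ordered graph with vertices $v_1<w_1<v_2<w_2<\dots<v_k<w_k$ and edges $v_1w_1,\dots,v_kw_k$. The online ordered Ramsey game for ordered graphs $G,H$ is played on vertex set $\mathbb N$ with its usual order: on each turn Builder draws a new edge between two vertices and Painter colors it red or blue; the game ends when there is a red copy of $G$ or a blue copy of $H$. Builder minimizes and Painter maximizes the number of turns; $r_o(G,H)$ is the number of turns under optimal play. *)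

theory Defs
  imports Main "HOL-Library.Extended_Nat"
begin

text \<open>
  The vertex order of an ordered graph is the order of the vertex type.  An undirected edge is
  represented by the pair (u, v) of its endpoints with u < v.
\<close>

record 'a ograph =
  verts :: "'a set"
  edges :: "('a \<times> 'a) set"

definition ordered_graph :: "'a::linorder ograph \<Rightarrow> bool" where
  "ordered_graph G \<longleftrightarrow> (\<forall>(u, v) \<in> edges G. u \<in> verts G \<and> v \<in> verts G \<and> u < v)"

definition osubgraph :: "'a::linorder ograph \<Rightarrow> 'a ograph \<Rightarrow> bool" where
  "osubgraph H G \<longleftrightarrow> ordered_graph H \<and> verts H \<subseteq> verts G \<and> edges H \<subseteq> edges G"

definition ograph_iso :: "('a::linorder \<Rightarrow> 'b::linorder) \<Rightarrow> 'a ograph \<Rightarrow> 'b ograph \<Rightarrow> bool" where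
  "ograph_iso f G H \<longleftrightarrow>
     bij_betw f (verts G) (verts H) \<and> strict_mono_on (verts G) f \<and>
     (\<forall>u \<in> verts G. \<forall>v \<in> verts G. (u, v) \<in> edges G \<longleftrightarrow> (f u, f v) \<in> edges H)"

definition contains_copy :: "'b::linorder ograph \<Rightarrow> 'a::linorder ograph \<Rightarrow> bool" where
  "contains_copy F G \<longleftrightarrow> (\<exists>H f. osubgraph H F \<and> ograph_iso f G H)"

text \<open>Vertices are numbered from 0.\<close>

definition ordered_path :: "nat \<Rightarrow> nat ograph" where
  "ordered_path n = \<lparr>verts = {0..<n}, edges = {(i, Suc i) | i. Suc i < n}\<rparr>"

definition serial_matching :: "nat \<Rightarrow> nat ograph" where
  "serial_matching k = \<lparr>verts = {0..<2 * k}, edges = {(2 * i, 2 * i + 1) | i. i < k}\<rparr>"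

datatype colour = Red | Blue

type_synonym edge = "nat \<times> nat"

text \<open>The moves made so far, in chronological order.\<close>

type_synonym history = "(edge \<times> colour) list"

type_synonym builder = "history \<Rightarrow> edge"

type_synonym painter = "history \<Rightarrow> edge \<Rightarrow> colour"

definition legal_builder :: "builder \<Rightarrow> bool" where
  "legal_builder \<beta> \<longleftrightarrow> (\<forall>h. fst (\<beta> h) < snd (\<beta> h) \<and> \<beta> h \<notin> fst ` set h)"

primrec play :: "builder \<Rightarrow> painter \<Rightarrow> nat \<Rightarrow> history" where
  "play \<beta> \<pi> 0 = []"
| "play \<beta> \<pi> (Suc t) = (let h = play \<beta> \<pi> t; e = \<beta> h in h @ [(e, \<pi> h e)])"

definition colour_graph :: "history \<Rightarrow> colour \<Rightarrow> nat ograph" where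
  "colour_graph h c = \<lparr>verts = UNIV, edges = {e. (e, c) \<in> set h}\<rparr>"

definition game_over :: "'a::linorder ograph \<Rightarrow> 'b::linorder ograph \<Rightarrow> history \<Rightarrow> bool" where
  "game_over G H h \<longleftrightarrow>
     contains_copy (colour_graph h Red) G \<or> contains_copy (colour_graph h Blue) H"

text \<open>
  The game ends at the first turn after which it is over; the moves that play prescribes
  beyond that turn are irrelevant.  A play that never ends has infinitely many turns.
\<close>

definition num_turns ::
    "'a::linorder ograph \<Rightarrow> 'b::linorder ograph \<Rightarrow> builder \<Rightarrow> painter \<Rightarrow> enat" where
  "num_turns G H \<beta> \<pi> = (INF t \<in> {t. game_over G H (play \<beta> \<pi> t)}. enat t)"

definition online_ordered_ramsey :: "'a::linorder ograph \<Rightarrow> 'b::linorder ograph \<Rightarrow> enat" where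
  "online_ordered_ramsey G H = (INF \<beta> \<in> {\<beta>. legal_builder \<beta>}. SUP \<pi>. num_turns G H \<beta> \<pi>)"

end

theory Submission
  imports Defs
begin

text \<open>
  Lower bound.  Painter colours an edge blue unless this completes a blue path with \<open>n\<close> vertices.
  Then no blue \<open>P\<^sub>n\<close> ever appears, and for every red edge \<open>uv\<close> the longest blue path ending at \<open>u\<close>
  and the longest one starting at \<open>v\<close> have together at least \<open>n - 2\<close> edges.  For the first edge
  \<open>u\<^sub>1v\<^sub>1\<close> of a red \<open>M\<^sub>k\<close> these two paths use \<open>n - 2\<close> edges; each later edge \<open>u\<^sub>jv\<^sub>j\<close>, with at most one
  exception, has an endpoint off them that forces a further blue edge.  These extra blue edges can
  be chosen distinct unless a short blue path leads from some \<open>v\<^sub>l\<close> to some \<open>u\<^sub>j\<close>; but then the longest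
  paths ending at \<open>u\<^sub>l\<close> and starting at \<open>v\<^sub>j\<close> are both long and disjoint, which again costs too many
  edges when \<open>n\<close> is large compared with \<open>k\<close>.  So there are at least \<open>n + k - 4\<close> blue edges and \<open>k\<close> red ones.

  Upper bound.  Builder extends a blue path to the right until an edge is red, and from then on to the
  left.  When the extension is red at the first vertex \<open>s\<close> of the path, Builder gives \<open>s\<close> up and joins
  the second vertex \<open>s'\<close> to a new vertex \<open>y\<close> between \<open>s\<close> and \<open>s'\<close>.  If this is blue, the path keeps its
  length and can be extended to the left again; if it is red, the red matching has grown.  Thus
  only one edge is wasted per red edge, and none for the first two.
\<close>

subsection \<open>Long walks in sparse acyclic graphs\<close>

text \<open>Vertices are peeled off one at a time: an edge with exactly one endpoint in
  \<open>X\<close> is charged to that endpoint and does not meet the rest of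
  \<open>X\<close>.\<close>

lemma card_edges_meeting:
  fixes B :: "('a \<times> 'a) set"
  assumes "finite X" and "finite B"
    and "\<And>Y. Y \<subseteq> X \<Longrightarrow> Y \<noteq> {} \<Longrightarrow> \<exists>e\<in>B. (fst e \<in> Y) \<noteq> (snd e \<in> Y)"
  shows "card X \<le> card {e \<in> B. fst e \<in> X \<or> snd e \<in> X}"
  using assms
proof (induction "card X" arbitrary: X)
  case 0
  then show ?case by simp
next
  case (Suc c)
  have "X \<noteq> {}" using Suc.hyps(2) by auto
  then obtain e where e: "e \<in> B" "(fst e \<in> X) \<noteq> (snd e \<in> X)"
    using Suc.prems(3)[of X] by auto
  define x where "x = (if fst e \<in> X then fst e else snd e)"
  have x: "x \<in> X" using e by (auto simp: x_def)
  let ?X = "X - {x}"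
  have "c = card ?X" using Suc.hyps(2) x Suc.prems(1) by simp
  moreover have "\<exists>e\<in>B. (fst e \<in> Y) \<noteq> (snd e \<in> Y)" if "Y \<subseteq> ?X" "Y \<noteq> {}" for Y
    using Suc.prems(3)[of Y] that by blast
  ultimately have IH: "c \<le> card {e \<in> B. fst e \<in> ?X \<or> snd e \<in> ?X}"
    using Suc.hyps(1)[of ?X] Suc.prems(1,2) by auto
  have "e \<notin> {e \<in> B. fst e \<in> ?X \<or> snd e \<in> ?X}"
    using e by (auto simp: x_def split: if_splits)
  moreover have "insert e {e \<in> B. fst e \<in> ?X \<or> snd e \<in> ?X} \<subseteq> {e \<in> B. fst e \<in> X \<or> snd e \<in> X}"
    using e by auto
  ultimately have "Suc (card {e \<in> B. fst e \<in> ?X \<or> snd e \<in> ?X})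
      \<le> card {e \<in> B. fst e \<in> X \<or> snd e \<in> X}"
    using card_mono[of "{e \<in> B. fst e \<in> X \<or> snd e \<in> X}"
        "insert e {e \<in> B. fst e \<in> ?X \<or> snd e \<in> ?X}"] Suc.prems(2) by simp
  then show ?case using IH Suc.hyps(2) by simp
qed

section \<open>Walks as relation powers, and longest walks\<close>

definition steps :: "(nat \<Rightarrow> 'a) \<Rightarrow> nat \<Rightarrow> ('a \<times> 'a) set" where
  "steps p a = (\<lambda>i. (p i, p (Suc i))) ` {..<a}"

lemma relpow_iff_steps: "(x, y) \<in> R ^^ a \<longleftrightarrow> (\<exists>p. p 0 = x \<and> p a = y \<and> steps p a \<subseteq> R)"
  unfolding relpow_fun_conv steps_def by blast

lemma relpow_trans: "(x, y) \<in> R ^^ a \<Longrightarrow> (y, z) \<in> R ^^ b \<Longrightarrow> (x, z) \<in> R ^^ (a + b)"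
  by (auto simp: relpow_add)

lemma steps_sub:
  assumes "steps p a \<subseteq> R" "i \<le> j" "j \<le> a"
  shows "(p i, p j) \<in> R ^^ (j - i)"
  unfolding relpow_fun_conv
  by (rule exI[of _ "\<lambda>m. p (i + m)"]) (use assms in \<open>auto simp: steps_def\<close>)

text \<open>\<open>B\<close> will be the set of blue edges. A walk with \<open>Suc N\<close> edges
  has \<open>N + 2 = n\<close> vertices, so \<open>no_long\<close> excludes a blue path on
  \<open>n\<close> vertices; it also bounds the lengths over which \<open>down\<close> and
  \<open>up\<close> take their maximum.\<close>

locale bounded_dag =
  fixes B :: "(nat \<times> nat) set" and N :: nat
  assumes finite_B: "finite B"
    and inc: "\<And>x y. (x, y) \<in> B \<Longrightarrow> x < y"
    and no_long: "B ^^ Suc N = {}"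
begin

definition down :: "nat \<Rightarrow> nat" where "down x = (GREATEST a. \<exists>s. (s, x) \<in> B ^^ a)"
definition up :: "nat \<Rightarrow> nat" where "up x = (GREATEST a. \<exists>t. (x, t) \<in> B ^^ a)"

lemma relpow_le_N: "(x, y) \<in> B ^^ a \<Longrightarrow> a \<le> N"
proof (rule ccontr)
  assume xy: "(x, y) \<in> B ^^ a" and "\<not> a \<le> N"
  then have "a = Suc N + (a - Suc N)" by simp
  then have "B ^^ a = B ^^ Suc N O B ^^ (a - Suc N)" by (metis relpow_add)
  then show False using xy no_long by simp
qed

lemma down_ge: "(s, x) \<in> B ^^ a \<Longrightarrow> a \<le> down x"
  unfolding down_def using Greatest_le_nat[of "\<lambda>a. \<exists>s. (s, x) \<in> B ^^ a" a N] relpow_le_N by blast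

lemma up_ge: "(x, t) \<in> B ^^ a \<Longrightarrow> a \<le> up x"
  unfolding up_def using Greatest_le_nat[of "\<lambda>a. \<exists>t. (x, t) \<in> B ^^ a" a N] relpow_le_N by blast

lemma down_walk: "\<exists>s. (s, x) \<in> B ^^ down x"
  unfolding down_def
  by (rule GreatestI_nat[of "\<lambda>a. \<exists>s. (s, x) \<in> B ^^ a" 0 N]) (use relpow_le_N in auto)

lemma up_walk: "\<exists>t. (x, t) \<in> B ^^ up x"
  unfolding up_def
  by (rule GreatestI_nat[of "\<lambda>a. \<exists>t. (x, t) \<in> B ^^ a" 0 N]) (use relpow_le_N in auto)

lemma down_up_le: "down x + up x \<le> N"
  using down_walk[of x] up_walk[of x] relpow_trans relpow_le_N by metis

lemma relpow_less: "(x, y) \<in> B ^^ a \<Longrightarrow> 0 < a \<Longrightarrow> x < y"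
proof (induction a arbitrary: y)
  case (Suc a)
  then obtain z where "(x, z) \<in> B ^^ a" "(z, y) \<in> B" by auto
  then show ?case using Suc.IH[of z] inc[of z y] by (cases "a = 0") auto
qed simp

lemma relpow_leq: "(x, y) \<in> B ^^ a \<Longrightarrow> x \<le> y"
  using relpow_less by (cases "a = 0") fastforce+

lemma card_steps:
  assumes "steps p a \<subseteq> B"
  shows "card (steps p a) = a"
proof -
  have "p i < p j" if "i < j" "j \<le> a" for i j
    using relpow_less[OF steps_sub[OF assms, of i j]] that by simp
  then have "inj_on (\<lambda>i. (p i, p (Suc i))) {..<a}"
    by (intro inj_onI) (metis fst_conv lessThan_iff less_imp_le_nat less_irrefl_nat linorder_neqE_nat)
  then show ?thesis by (simp add: steps_def card_image)
qed

text \<open>A longer walk from \<open>q i\<close>, prefixed with the first \<open>i\<close> edges of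
  \<open>q\<close>, would beat a longest walk from \<open>x\<close>; so every tail of a longest walk
  is longest too.\<close>

lemma longest_up:
  obtains q where "q 0 = x" "steps q (up x) \<subseteq> B" "\<And>i. i \<le> up x \<Longrightarrow> up (q i) = up x - i"
proof -
  obtain q where q: "q 0 = x" "steps q (up x) \<subseteq> B"
    using up_walk[of x] by (auto simp: relpow_iff_steps)
  have "up (q i) = up x - i" if i: "i \<le> up x" for i
  proof -
    obtain t where t: "(q i, t) \<in> B ^^ up (q i)" using up_walk by blast
    have "(x, q i) \<in> B ^^ i" using steps_sub[OF q(2), of 0 i] q(1) i by simp
    from up_ge[OF relpow_trans[OF this t]] up_ge[OF steps_sub[OF q(2), of i "up x"]] i
    show ?thesis by simp
  qed
  with q that show thesis by blast
qed

lemma longest_down: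
  obtains p where "p (down x) = x" "steps p (down x) \<subseteq> B" "down (p 0) = 0"
proof -
  obtain p where p: "p (down x) = x" "steps p (down x) \<subseteq> B"
    using down_walk[of x] by (auto simp: relpow_iff_steps)
  obtain t where t: "(t, p 0) \<in> B ^^ down (p 0)" using down_walk by blast
  have "(p 0, x) \<in> B ^^ down x" using steps_sub[OF p(2), of 0 "down x"] p(1) by simp
  from down_ge[OF relpow_trans[OF t this]] have "down (p 0) = 0" by simp
  with p that show thesis by blast
qed

text \<open>Confining the edges of a walk to the interval between its ends is how the edge sets of
  two walks are shown to be disjoint.\<close>

lemma steps_bounds:
  assumes "steps p a \<subseteq> B" "(x, y) \<in> steps p a"
  shows "p 0 \<le> x" "x < y" "y \<le> p a"
proof -
  obtain i where i: "i < a" "x = p i" "y = p (Suc i)" using assms(2) by (auto simp: steps_def)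
  show "p 0 \<le> x" using relpow_leq[OF steps_sub[OF assms(1), of 0 i]] i by simp
  show "y \<le> p a" using relpow_leq[OF steps_sub[OF assms(1), of "Suc i" a]] i by simp
  show "x < y" using assms inc by blast
qed

lemma steps_closed_forward:
  assumes "steps q a \<subseteq> B" "q 0 \<in> Y" "\<And>x y. (x, y) \<in> B \<Longrightarrow> x \<in> Y \<longleftrightarrow> y \<in> Y" "i \<le> a"
  shows "q i \<in> Y"
  using \<open>i \<le> a\<close>
proof (induction i)
  case (Suc i)
  then have "(q i, q (Suc i)) \<in> B" using assms(1) by (auto simp: steps_def)
  with Suc assms(3) show ?case by auto
qed (use assms in simp)

lemma steps_closed_backward:
  assumes "steps q a \<subseteq> B" "q a \<in> Y" "\<And>x y. (x, y) \<in> B \<Longrightarrow> x \<in> Y \<longleftrightarrow> y \<in> Y" "i \<le> a"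
  shows "q i \<in> Y"
  using \<open>i \<le> a\<close>
proof (induction rule: inc_induct)
  case (step i)
  then have "(q i, q (Suc i)) \<in> B" using assms(1) by (auto simp: steps_def)
  with step assms(3) show ?case by auto
qed (use assms in simp)

text \<open>
  Here \<open>N\<close> is \<open>n - 2\<close>, and \<open>u i\<close>, \<open>v i\<close> are the endpoints of the red edges, indexed from 0.
\<close>

lemma card_ge:
  assumes "1 \<le> N" "2 \<le> k" "3 * k \<le> N + 5"
    and uv: "\<And>i. i < k \<Longrightarrow> u i < v i"
    and vu: "\<And>i j. i < j \<Longrightarrow> j < k \<Longrightarrow> v i < u j"
    and far: "\<And>i. i < k \<Longrightarrow> N \<le> down (u i) + up (v i)"
  shows "N + k \<le> card B + 2"
proof (rule ccontr)
  assume "\<not> ?thesis"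
  then have small: "card B + 3 \<le> N + k" by simp
  define b where "b = up (v 0)"
  obtain q where q: "q 0 = v 0" "steps q b \<subseteq> B" "\<And>i. i \<le> b \<Longrightarrow> up (q i) = b - i"
    unfolding b_def using longest_up by metis
  obtain p where p: "p (down (u 0)) = u 0" "steps p (down (u 0)) \<subseteq> B"
    using longest_down by metis
  define V where "V = q ` {..b}"
  define Q where "Q = steps p (down (u 0)) \<union> steps q b"
  have Q_B: "Q \<subseteq> B" using p q by (simp add: Q_def)
  have Q_card: "N \<le> card Q"
  proof -
    \<comment> \<open>The first walk ends at \<open>u 0\<close>, below the start \<open>v 0\<close>
      of the second.\<close>
    have "steps p (down (u 0)) \<inter> steps q b = {}"
      using steps_bounds[OF p(2)] steps_bounds[OF q(2)] p(1) q(1) uv[of 0] \<open>2 \<le> k\<close>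
      by (fastforce dest: less_le_trans)
    then have "card Q = down (u 0) + b"
      unfolding Q_def using card_steps[OF p(2)] card_steps[OF q(2)]
      by (subst card_Un_disjoint) (auto simp: steps_def)
    then show ?thesis using far[of 0] \<open>2 \<le> k\<close> by (simp add: b_def)
  qed
  have inj_u: "i = j" if "u i = u j" "i < k" "j < k" for i j
    using that uv vu by (metis less_asym' linorder_neqE_nat)
  have inj_v: "i = j" if "v i = v j" "i < k" "j < k" for i j
    using that uv vu by (metis less_asym' linorder_neqE_nat)
  have u_v: "u i \<noteq> v j" if "i < k" "j < k" for i j
    using that uv[of i] uv[of j] vu[of i j] vu[of j i] by (cases i j rule: linorder_cases) auto
  have q_less: "q i < q j" if "i < j" "j \<le> b" for i j
    using relpow_less[OF steps_sub[OF q(2), of i j]] that by simp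
  \<comment> \<open>\<open>?U j\<close> gives a blue edge into \<open>u j\<close>, and
    \<open>?W j\<close> one out of \<open>v j\<close>, in both cases at a vertex off the walk
    \<open>q\<close>.\<close>
  let ?U = "\<lambda>j. u j \<notin> V \<and> 1 \<le> down (u j)"
  let ?W = "\<lambda>j. v j \<notin> V \<and> 1 \<le> up (v j)"
  \<comment> \<open>An exceptional \<open>j\<close> turns out to have \<open>up (v j) = 0\<close>,
    hence \<open>down (u j) = N\<close>; this puts \<open>u j\<close> on \<open>q\<close> at the
    place where \<open>up\<close> vanishes, its end.\<close>
  have exc: "u j = q b" if j: "1 \<le> j" "j < k" and bad: "\<not> ?U j" "\<not> ?W j" for j
  proof -
    have v0: "v 0 < u j" using vu[of 0 j] j by simp
    \<comment> \<open>Along \<open>q\<close> the value of \<open>up\<close> drops by one per step,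
      so for \<open>u j = q s\<close> and \<open>v j = q t\<close> with \<open>s < t\<close> the sum
      in \<open>far\<close> is at most \<open>N - (t - s)\<close>.\<close>
    have off: "\<not> (u j \<in> V \<and> v j \<in> V)"
    proof
      assume "u j \<in> V \<and> v j \<in> V"
      then obtain s t where st: "u j = q s" "s \<le> b" "v j = q t" "t \<le> b" by (auto simp: V_def)
      have "s < t" using st uv[of j] j q_less[of t s] by (metis less_asym' linorder_neqE_nat)
      moreover have "down (u j) + (b - s) \<le> N" using down_up_le[of "u j"] st q(3) by simp
      moreover have "up (v j) = b - t" using st q(3) by simp
      ultimately show False using far[of j] j st by simp
    qed
    have "\<not> v j \<in> V"
    proof
      assume "v j \<in> V"
      with off bad have "down (u j) = 0" by auto
      with far[of j] j have "N \<le> up (v j)" by simp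
      moreover obtain t where t: "v j = q t" "t \<le> b" using \<open>v j \<in> V\<close> by (auto simp: V_def)
      moreover have "b \<le> N" using down_up_le[of "v 0"] by (simp add: b_def)
      ultimately have "t = 0" using q(3)[of t] \<open>1 \<le> N\<close> by simp
      then show False using t q(1) v0 uv[of j] j by simp
    qed
    with bad have "up (v j) = 0" by auto
    with far[of j] j have d: "N \<le> down (u j)" by simp
    with bad \<open>1 \<le> N\<close> have "u j \<in> V" by auto
    then obtain s where s: "u j = q s" "s \<le> b" by (auto simp: V_def)
    with down_up_le[of "u j"] d q(3) have "s = b" by simp
    with s show ?thesis by simp
  qed
  define T where "T = {j. 1 \<le> j \<and> j < k \<and> (?U j \<or> ?W j)}"
  \<comment> \<open>The indices lost are \<open>0\<close>, which already pays for \<open>Q\<close>,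
    and at most one exception, since \<open>q b\<close> is a single vertex and the
    \<open>u j\<close> are distinct.\<close>
  have T_card: "k \<le> card T + 2"
  proof -
    let ?D = "{j. 1 \<le> j \<and> j < k} - T"
    have "\<exists>j0. ?D \<subseteq> {j0}"
    proof (cases "?D = {}")
      case False
      then obtain j0 where "j0 \<in> ?D" by auto
      then have j0: "1 \<le> j0" "j0 < k" "u j0 = q b" using exc by (auto simp: T_def)
      have "j = j0" if "j \<in> ?D" for j
      proof -
        have "1 \<le> j" "j < k" "u j = q b" using exc that by (auto simp: T_def)
        with j0 show ?thesis using inj_u by simp
      qed
      then have "?D \<subseteq> {j0}" by blast
      then show ?thesis by blast
    qed auto
    then obtain j0 where "?D \<subseteq> {j0}" by blast
    then have "card ?D \<le> 1" using card_mono[of "{j0}" ?D] by simp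
    moreover have "{j. 1 \<le> j \<and> j < k} = {1..<k}" by auto
    then have "card {j. 1 \<le> j \<and> j < k} = k - 1" by simp
    moreover have "card {j. 1 \<le> j \<and> j < k} - card T \<le> card ?D"
      by (rule diff_card_le_card_Diff) (simp add: T_def)
    ultimately show ?thesis by simp
  qed
  define x where "x j = (if ?U j then u j else v j)" for j
  define X where "X = x ` T"
  have "inj_on x T"
  proof (rule inj_onI)
    fix i j
    assume "i \<in> T" "j \<in> T" "x i = x j"
    then show "i = j"
      using inj_u[of i j] inj_v[of i j] u_v[of i j] u_v[of j i]
      by (simp add: x_def T_def split: if_splits)
  qed
  then have X_card: "card X = card T" by (simp add: X_def card_image)
  have X_cases: "(\<exists>j. 1 \<le> j \<and> j < k \<and> y = u j \<and> 1 \<le> down y) \<or> (\<exists>j. 1 \<le> j \<and> j < k \<and> y = v j \<and> 1 \<le> up y)"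
    if "y \<in> X" for y
    using that by (auto simp: X_def T_def x_def split: if_splits)
  have X_V: "y \<notin> V" if "y \<in> X" for y
    using that by (auto simp: X_def T_def x_def split: if_splits)
  have X_gt: "v 0 < y" if "y \<in> X" for y
  proof -
    have "v 0 < u j \<and> v 0 < v j" if "1 \<le> j" "j < k" for j
      using vu[of 0 j] uv[of j] that by simp
    with X_cases[OF that] show ?thesis by blast
  qed
  have finite_X: "finite X" by (simp add: X_def T_def)
  let ?EX = "{e \<in> B. fst e \<in> X \<or> snd e \<in> X}"
  \<comment> \<open>Edges of \<open>p\<close> stay below \<open>v 0\<close> and those of
    \<open>q\<close> inside \<open>V\<close>, while \<open>X\<close> lies above \<open>v 0\<close>
    and off \<open>V\<close>.\<close>
  have "Q \<inter> ?EX = {}"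
  proof -
    have "e \<notin> ?EX" if "e \<in> steps p (down (u 0))" for e
    proof -
      have "fst e < snd e" "snd e \<le> u 0"
        using steps_bounds[OF p(2), of "fst e" "snd e"] that p(1) by auto
      then show ?thesis using X_gt uv[of 0] \<open>2 \<le> k\<close> by fastforce
    qed
    moreover have "e \<notin> ?EX" if e: "e \<in> steps q b" for e
    proof -
      obtain i where "i < b" "e = (q i, q (Suc i))" using e by (auto simp: steps_def)
      then have "fst e \<in> V" "snd e \<in> V" by (auto simp: V_def)
      then show ?thesis using X_V by blast
    qed
    ultimately show ?thesis by (auto simp: Q_def)
  qed
  then have card_off: "N + card S \<le> card B" if "S \<subseteq> ?EX" for S
  proof -
    have "card (Q \<union> S) = card Q + card S"
      using that \<open>Q \<inter> ?EX = {}\<close> finite_B Q_B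
      by (intro card_Un_disjoint) (auto intro: finite_subset)
    moreover have "card (Q \<union> S) \<le> card B"
      using that Q_B finite_B by (intro card_mono) auto
    ultimately show ?thesis using Q_card by simp
  qed
  have "card X \<le> card ?EX"
  proof (rule card_edges_meeting[OF finite_X finite_B])
    fix Y assume Y: "Y \<subseteq> X" "Y \<noteq> {}"
    show "\<exists>e\<in>B. (fst e \<in> Y) \<noteq> (snd e \<in> Y)"
    proof (rule ccontr)
      assume "\<not> ?thesis"
      then have closed: "x \<in> Y \<longleftrightarrow> y \<in> Y" if "(x, y) \<in> B" for x y using that by fastforce
      \<comment> \<open>No edge crosses the boundary of \<open>Y\<close>, so a longest walk ending
        in \<open>Y\<close> stays there and avoids \<open>Q\<close>; by \<open>small\<close> at most
        \<open>k - 3\<close> blue edges are left for it.\<close>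
      have down_small: "down y + 3 \<le> k" if "y \<in> Y" for y
      proof -
        obtain r where r: "r (down y) = y" "steps r (down y) \<subseteq> B" using longest_down by metis
        have "r i \<in> Y" if "i \<le> down y" for i
          using steps_closed_backward[OF r(2) _ closed that] r(1) \<open>y \<in> Y\<close> by simp
        then have "steps r (down y) \<subseteq> ?EX" using r(2) Y(1) by (auto simp: steps_def)
        from card_off[OF this] card_steps[OF r(2)] small show ?thesis by simp
      qed
      have up_small: "up y + 3 \<le> k" if "y \<in> Y" for y
      proof -
        obtain r where r: "r 0 = y" "steps r (up y) \<subseteq> B" using longest_up by metis
        have "r i \<in> Y" if "i \<le> up y" for i
          using steps_closed_forward[OF r(2) _ closed that] r(1) \<open>y \<in> Y\<close> by simp
        then have "steps r (up y) \<subseteq> ?EX" using r(2) Y(1) by (auto simp: steps_def)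
        from card_off[OF this] card_steps[OF r(2)] small show ?thesis by simp
      qed
      \<comment> \<open>A longest walk to a vertex \<open>u j\<close> of \<open>Y\<close> starts in
        \<open>Y\<close> with \<open>down = 0\<close>, and in \<open>X\<close> only some
        \<open>v l\<close> can have that. Symmetrically, a longest walk from some \<open>v j\<close>
        ends at some \<open>u l\<close>.\<close>
      have "\<exists>l j. l < k \<and> j < k \<and> v l \<in> Y \<and> u j \<in> Y \<and> v l \<le> u j"
      proof -
        obtain y where y: "y \<in> Y" using Y by auto
        then consider j where "j < k" "y = u j" | j where "j < k" "y = v j"
          using X_cases Y(1) by blast
        then show ?thesis
        proof cases
          case 1
          obtain r where r: "r (down y) = y" "steps r (down y) \<subseteq> B" "down (r 0) = 0"
            using longest_down by metis
          have "r 0 \<in> Y" using steps_closed_backward[OF r(2) _ closed, of 0] r(1) y by simp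
          then obtain l where "l < k" "r 0 = v l" using X_cases[of "r 0"] Y(1) r(3) by auto
          moreover have "r 0 \<le> y" using relpow_leq[OF steps_sub[OF r(2), of 0 "down y"]] r(1) by simp
          ultimately show ?thesis using 1 y \<open>r 0 \<in> Y\<close> by metis
        next
          case 2
          obtain r where r: "r 0 = y" "steps r (up y) \<subseteq> B" "\<And>i. i \<le> up y \<Longrightarrow> up (r i) = up y - i"
            using longest_up by metis
          have rY: "r (up y) \<in> Y" using steps_closed_forward[OF r(2) _ closed, of "up y"] r(1) y by simp
          then obtain l where "l < k" "r (up y) = u l"
            using X_cases[of "r (up y)"] Y(1) r(3)[of "up y"] by auto
          moreover have "y \<le> r (up y)" using relpow_leq[OF steps_sub[OF r(2), of 0 "up y"]] r(1) by simp
          ultimately show ?thesis using 2 y rY by metis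
        qed
      qed
      then obtain l j where lj: "l < k" "j < k" "v l \<in> Y" "u j \<in> Y" "v l \<le> u j" by blast
      have big: "N + 3 \<le> down (u l) + k" "N + 3 \<le> up (v j) + k"
        using far[of l] far[of j] up_small[of "v l"] down_small[of "u j"] lj by auto
      obtain r where r: "r (down (u l)) = u l" "steps r (down (u l)) \<subseteq> B"
        using longest_down by metis
      obtain s where s: "s 0 = v j" "steps s (up (v j)) \<subseteq> B" using longest_up by metis
      have "u l < v j" using lj uv[of l] uv[of j] by simp
      then have "steps r (down (u l)) \<inter> steps s (up (v j)) = {}"
        using steps_bounds[OF r(2)] steps_bounds[OF s(2)] r(1) s(1)
        by (fastforce dest: less_le_trans)
      then have "card (steps r (down (u l)) \<union> steps s (up (v j))) = down (u l) + up (v j)"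
        using card_steps[OF r(2)] card_steps[OF s(2)]
        by (subst card_Un_disjoint) (auto simp: steps_def)
      moreover have "card (steps r (down (u l)) \<union> steps s (up (v j))) \<le> card B"
        using r s finite_B by (intro card_mono) auto
      \<comment> \<open>Two disjoint walks give \<open>2 * (N + 3 - k) \<le> card B\<close>, while
        \<open>card B + 3 \<le> N + k\<close>; this is where \<open>3 * k \<le> N + 5\<close>
        enters.\<close>
      ultimately show False using big small assms(3) by simp
    qed
  qed
  with card_off[of ?EX] X_card T_card small show False by simp
qed

end

subsection \<open>The painter\<close>

text \<open>A copy need not be induced, so \<open>f\<close> only has to preserve edges: the witness
  \<open>H\<close> has exactly the images of the edges of \<open>G\<close>, and injectivity of
  \<open>f\<close> yields the reverse implication.\<close>

lemma contains_copy_colour_graph: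
  assumes "ordered_graph G"
  shows "contains_copy (colour_graph h c) G \<longleftrightarrow>
    (\<exists>f. strict_mono_on (verts G) f \<and> (\<forall>(x, y) \<in> edges G. ((f x, f y), c) \<in> set h))"
    (is "?l \<longleftrightarrow> ?r")
proof
  assume ?l
  then obtain H f where H: "osubgraph H (colour_graph h c)" "ograph_iso f G H"
    by (auto simp: contains_copy_def)
  have "((f x, f y), c) \<in> set h" if "(x, y) \<in> edges G" for x y
  proof -
    have "x \<in> verts G" "y \<in> verts G" using that assms by (auto simp: ordered_graph_def)
    then have "(f x, f y) \<in> edges H" using H(2) that by (auto simp: ograph_iso_def)
    then show ?thesis using H(1) by (auto simp: osubgraph_def colour_graph_def)
  qed
  then show ?r using H(2) by (auto simp: ograph_iso_def)
next
  assume ?r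
  then obtain f where f: "strict_mono_on (verts G) f"
    "\<And>x y. (x, y) \<in> edges G \<Longrightarrow> ((f x, f y), c) \<in> set h" by blast
  have G: "x \<in> verts G" "y \<in> verts G" "x < y" if "(x, y) \<in> edges G" for x y
    using assms that by (auto simp: ordered_graph_def)
  have inj: "inj_on f (verts G)" using f(1) by (rule strict_mono_on_imp_inj_on)
  define H where "H = \<lparr>verts = f ` verts G, edges = map_prod f f ` edges G\<rparr>"
  have "ordered_graph H"
    using G strict_mono_onD[OF f(1)] by (fastforce simp: ordered_graph_def H_def)
  then have "osubgraph H (colour_graph h c)"
    using f(2) by (auto simp: osubgraph_def H_def colour_graph_def)
  moreover have "ograph_iso f G H"
    unfolding ograph_iso_def
  proof (intro conjI ballI iffI)
    show "bij_betw f (verts G) (verts H)" using inj by (simp add: H_def bij_betw_def)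
    show "(f u, f v) \<in> edges H" if "(u, v) \<in> edges G" for u v
      using that by (auto simp: H_def)
    show "(u, v) \<in> edges G" if uv: "u \<in> verts G" "v \<in> verts G" "(f u, f v) \<in> edges H" for u v
    proof -
      obtain x y where "(x, y) \<in> edges G" "f u = f x" "f v = f y"
        using uv(3) by (auto simp: H_def)
      with G[of x y] inj_onD[OF inj] uv show ?thesis by metis
    qed
  qed (rule f(1))
  ultimately show ?l by (auto simp: contains_copy_def)
qed

lemma ordered_graph_path: "ordered_graph (ordered_path n)"
  by (auto simp: ordered_graph_def ordered_path_def)

lemma ordered_graph_matching: "ordered_graph (serial_matching k)"
  by (auto simp: ordered_graph_def serial_matching_def)

section \<open>Bookkeeping on plays and colour classes\<close>

lemma length_play [simp]: "length (play \<beta> \<pi> t) = t"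
  by (induction t) (auto simp: Let_def)

lemma distinct_play: "legal_builder \<beta> \<Longrightarrow> distinct (map fst (play \<beta> \<pi> t))"
  by (induction t) (auto simp: Let_def legal_builder_def)

lemma play_increasing: "legal_builder \<beta> \<Longrightarrow> ((x, y), c) \<in> set (play \<beta> \<pi> t) \<Longrightarrow> x < y"
  by (induction t) (auto simp: Let_def legal_builder_def; metis fst_conv snd_conv)+

definition coloured :: "history \<Rightarrow> colour \<Rightarrow> edge set" where
  "coloured h c = {e. (e, c) \<in> set h}"

lemma mem_coloured: "e \<in> coloured h c \<longleftrightarrow> (e, c) \<in> set h"
  by (simp add: coloured_def)

lemma coloured_snoc:
  "coloured (h @ [(e, d)]) c = (if d = c then insert e (coloured h c) else coloured h c)"
  by (auto simp: coloured_def)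

lemma finite_coloured [simp]: "finite (coloured h c)"
  by (rule finite_subset[of _ "fst ` set h"]) (force simp: coloured_def)+

lemma card_coloured:
  assumes "distinct (map fst h)"
  shows "card (coloured h Red) + card (coloured h Blue) \<le> length h"
proof -
  have "coloured h Red \<inter> coloured h Blue = {}"
    using assms by (force simp: coloured_def distinct_map inj_on_def)
  then have "card (coloured h Red) + card (coloured h Blue) = card (coloured h Red \<union> coloured h Blue)"
    by (simp add: card_Un_disjoint)
  also have "\<dots> \<le> card (fst ` set h)"
    by (rule card_mono) (force simp: coloured_def)+
  also have "\<dots> \<le> length h"
    by (meson card_image_le card_length finite_set le_trans)
  finally show ?thesis .
qed

text \<open>An increasing walk cannot return to \<open>u\<close> after using \<open>(u, v)\<close>,
  so the new edge occurs at most once and splits the walk in two.\<close>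

lemma relpow_insert_edge:
  fixes B :: "('a::linorder \<times> 'a) set"
  assumes inc: "\<And>x y. (x, y) \<in> insert (u, v) B \<Longrightarrow> x < y"
    and "(x, y) \<in> insert (u, v) B ^^ m"
  shows "(x, y) \<in> B ^^ m \<or> (\<exists>a b. a + b + 1 = m \<and> (x, u) \<in> B ^^ a \<and> (v, y) \<in> B ^^ b)"
  using assms(2)
proof (induction m arbitrary: y)
  case (Suc m)
  have leq: "s \<le> t" if "(s, t) \<in> B ^^ b" for s t b
    using that
  proof (induction b arbitrary: t)
    case (Suc b)
    then obtain z where "(s, z) \<in> B ^^ b" "(z, t) \<in> B" by auto
    with Suc.IH[of z] inc[of z t] show ?case by auto
  qed simp
  obtain z where z: "(x, z) \<in> insert (u, v) B ^^ m" "(z, y) \<in> insert (u, v) B"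
    using Suc.prems by auto
  from Suc.IH[OF z(1)] show ?case
  proof
    assume xz: "(x, z) \<in> B ^^ m"
    show ?thesis
    proof (cases "(z, y) \<in> B")
      case True
      with xz show ?thesis by auto
    next
      case False
      with z(2) have "z = u" "y = v" by auto
      with xz have "m + 0 + 1 = Suc m \<and> (x, u) \<in> B ^^ m \<and> (v, y) \<in> B ^^ 0" by simp
      then show ?thesis by blast
    qed
  next
    assume "\<exists>a b. a + b + 1 = m \<and> (x, u) \<in> B ^^ a \<and> (v, z) \<in> B ^^ b"
    then obtain a b where ab: "a + b + 1 = m" "(x, u) \<in> B ^^ a" "(v, z) \<in> B ^^ b" by blast
    then have "u < z" using leq[of v z b] inc[of u v] by auto
    with z(2) have "(z, y) \<in> B" by auto
    with ab have "a + Suc b + 1 = Suc m \<and> (x, u) \<in> B ^^ a \<and> (v, y) \<in> B ^^ Suc b" by auto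
    then show ?thesis by blast
  qed
qed simp

section \<open>The painter that avoids long blue walks\<close>

definition cautious_painter :: "nat \<Rightarrow> painter" where
  "cautious_painter N h e = (if insert e (coloured h Blue) ^^ Suc N = {} then Blue else Red)"

text \<open>An edge is painted red only if blue would complete a walk with \<open>Suc N\<close>
  edges. That walk uses the edge, by the first claim, and cutting it there leaves \<open>N\<close>
  blue edges in two walks, which survive because blue edges are only added later.\<close>

lemma cautious_play:
  fixes \<beta> N
  assumes legal: "legal_builder \<beta>"
  defines "\<pi> \<equiv> cautious_painter N"
  shows "coloured (play \<beta> \<pi> t) Blue ^^ Suc N = {}"
    and "(u, v) \<in> coloured (play \<beta> \<pi> t) Red \<Longrightarrow>
      \<exists>a b x y. a + b = N \<and> (x, u) \<in> coloured (play \<beta> \<pi> t) Blue ^^ a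
        \<and> (v, y) \<in> coloured (play \<beta> \<pi> t) Blue ^^ b"
proof (induction t)
  case 0
  {
    case 1
    have "coloured (play \<beta> \<pi> 0) Blue = {}" by (simp add: coloured_def)
    then show ?case by (simp add: relpow_commute[symmetric])
  next
    case 2
    then show ?case by (simp add: coloured_def)
  }
next
  case (Suc t)
  let ?h = "play \<beta> \<pi> t"
  let ?e = "\<beta> ?h"
  let ?B = "coloured ?h Blue"
  have play: "play \<beta> \<pi> (Suc t) = ?h @ [(?e, \<pi> ?h ?e)]" by (simp add: Let_def)
  show "coloured (play \<beta> \<pi> (Suc t)) Blue ^^ Suc N = {}"
  proof (cases "\<pi> ?h ?e")
    case Red
    then show ?thesis using Suc.IH(1) unfolding play coloured_snoc by (simp del: relpow.simps)
  next
    case Blue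
    then have "insert ?e ?B ^^ Suc N = {}"
      by (simp add: \<pi>_def cautious_painter_def del: relpow.simps split: if_splits)
    then show ?thesis unfolding play coloured_snoc Blue by (simp del: relpow.simps)
  qed
  assume uv: "(u, v) \<in> coloured (play \<beta> \<pi> (Suc t)) Red"
  have mono: "?B ^^ a \<subseteq> coloured (play \<beta> \<pi> (Suc t)) Blue ^^ a" for a
    unfolding play coloured_snoc by (induction a) (auto split: if_splits)
  have "\<exists>a b x y. a + b = N \<and> (x, u) \<in> ?B ^^ a \<and> (v, y) \<in> ?B ^^ b"
  proof (cases "(u, v) \<in> coloured ?h Red")
    case True
    then show ?thesis by (rule Suc.IH(2))
  next
    case False
    with uv have e: "?e = (u, v)" "\<pi> ?h ?e = Red"
      unfolding play coloured_snoc by (auto split: if_splits)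
    then have "insert (u, v) ?B ^^ Suc N \<noteq> {}"
      by (simp add: \<pi>_def cautious_painter_def del: relpow.simps split: if_splits)
    then obtain x y where xy: "(x, y) \<in> insert (u, v) ?B ^^ Suc N" by (auto simp del: relpow.simps)
    have "x < y" if "(x, y) \<in> insert (u, v) ?B" for x y
      using that e(1) legal play_increasing[OF legal]
      by (auto simp: coloured_def legal_builder_def) (metis fst_conv snd_conv)
    from relpow_insert_edge[OF this xy] Suc.IH(1) show ?thesis
      by (auto simp del: relpow.simps)
  qed
  with mono show "\<exists>a b x y. a + b = N \<and> (x, u) \<in> coloured (play \<beta> \<pi> (Suc t)) Blue ^^ a
        \<and> (v, y) \<in> coloured (play \<beta> \<pi> (Suc t)) Blue ^^ b"
    by blast
qed

lemma cautious_num_turns: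
  assumes legal: "legal_builder \<beta>" and "3 \<le> n" "2 \<le> k" "3 * k \<le> n + 3"
  shows "enat (n + 2 * k - 4) \<le> num_turns (serial_matching k) (ordered_path n) \<beta> (cautious_painter (n - 2))"
  unfolding num_turns_def
proof (rule INF_greatest)
  fix t
  let ?\<pi> = "cautious_painter (n - 2)"
  let ?h = "play \<beta> ?\<pi> t"
  let ?B = "coloured ?h Blue"
  assume "t \<in> {t. game_over (serial_matching k) (ordered_path n) (play \<beta> ?\<pi> t)}"
  moreover have "\<not> contains_copy (colour_graph ?h Blue) (ordered_path n)"
  proof
    assume "contains_copy (colour_graph ?h Blue) (ordered_path n)"
    then obtain f where "\<And>i. Suc i < n \<Longrightarrow> (f i, f (Suc i)) \<in> ?B"
      unfolding contains_copy_colour_graph[OF ordered_graph_path]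
      by (auto simp: ordered_path_def coloured_def)
    \<comment> \<open>A path on \<open>n\<close> vertices has \<open>n - 1 = Suc (n - 2)\<close>
      edges.\<close>
    then have "(f 0, f (Suc (n - 2))) \<in> ?B ^^ Suc (n - 2)"
      unfolding relpow_fun_conv using \<open>3 \<le> n\<close> by (intro exI[of _ f]) auto
    then show False using cautious_play(1)[OF legal, of "n - 2" t] by (simp del: relpow.simps)
  qed
  ultimately have "contains_copy (colour_graph ?h Red) (serial_matching k)"
    by (simp add: game_over_def)
  then obtain f where f: "strict_mono_on {0..<2 * k} f"
    "\<And>i. i < k \<Longrightarrow> (f (2 * i), f (2 * i + 1)) \<in> coloured ?h Red"
    unfolding contains_copy_colour_graph[OF ordered_graph_matching]
    by (auto simp: serial_matching_def coloured_def)
  interpret bounded_dag ?B "n - 2"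
    using cautious_play(1)[OF legal, of "n - 2" t] play_increasing[OF legal]
    by unfold_locales (simp_all add: mem_coloured del: relpow.simps)
  have "n - 2 + k \<le> card ?B + 2"
  proof (rule card_ge[where u = "\<lambda>i. f (2 * i)" and v = "\<lambda>i. f (2 * i + 1)"])
    fix i assume "i < k"
    from cautious_play(2)[OF legal f(2)[OF this]] down_ge up_ge
    show "n - 2 \<le> down (f (2 * i)) + up (f (2 * i + 1))" by (metis add_mono)
  qed (use assms strict_mono_onD[OF f(1)] in auto)
  moreover have "k \<le> card (coloured ?h Red)"
  proof -
    have "inj_on (\<lambda>i. (f (2 * i), f (2 * i + 1))) {..<k}"
      using inj_onD[OF strict_mono_on_imp_inj_on[OF f(1)]] by (fastforce intro: inj_onI)
    moreover have "(\<lambda>i. (f (2 * i), f (2 * i + 1))) ` {..<k} \<subseteq> coloured ?h Red"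
      using f(2) by auto
    ultimately show ?thesis
      using card_inj_on_le[of _ "{..<k}" "coloured ?h Red"] by fastforce
  qed
  moreover have "card (coloured ?h Red) + card ?B \<le> t"
    using card_coloured[OF distinct_play[OF legal], of ?\<pi> t] by simp
  ultimately show "enat (n + 2 * k - 4) \<le> enat t" using \<open>3 \<le> n\<close> by simp
qed

lemma ramsey_ge:
  assumes "3 \<le> n" "2 \<le> k" "3 * k \<le> n + 3"
  shows "enat (n + 2 * k - 4) \<le> online_ordered_ramsey (serial_matching k) (ordered_path n)"
  unfolding online_ordered_ramsey_def
  by (rule INF_greatest) (use cautious_num_turns[OF _ assms] in \<open>auto intro: SUP_upper2\<close>)

subsection \<open>The builder\<close>

primrec builder_wins :: "(history \<Rightarrow> bool) \<Rightarrow> nat \<Rightarrow> history \<Rightarrow> bool" where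
  "builder_wins ov 0 h \<longleftrightarrow> ov h"
| "builder_wins ov (Suc t) h \<longleftrightarrow> ov h \<or>
     (\<exists>e. fst e < snd e \<and> e \<notin> fst ` set h \<and> (\<forall>c. builder_wins ov t (h @ [(e, c)])))"

text \<open>The number of turns left can be read off the length of the history, so the winning moves
  in the game tree combine into one strategy.\<close>

lemma ramsey_le:
  assumes "builder_wins (game_over G H) N []"
  shows "online_ordered_ramsey G H \<le> enat N"
proof -
  let ?win = "builder_wins (game_over G H)"
  let ?legal = "\<lambda>h e. fst e < snd e \<and> e \<notin> fst ` set (h :: history)"
  let ?good = "\<lambda>h e. ?legal h e \<and> (\<forall>c. ?win (N - Suc (length h)) (h @ [(e, c)]))"
  \<comment> \<open>Legality is demanded at every history, so where no winning move exists the
    choice falls back on an arbitrary legal edge.\<close>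
  define \<beta> where "\<beta> h = (SOME e. ?legal h e \<and> ((\<exists>e. ?good h e) \<longrightarrow> ?good h e))" for h
  have "\<exists>e. ?legal h e" for h
  proof -
    have "infinite (range (\<lambda>m. (0 :: nat, Suc m)))"
      by (rule range_inj_infinite) (simp add: inj_def)
    then have "\<not> range (\<lambda>m. (0, Suc m)) \<subseteq> fst ` set h"
      using finite_subset by blast
    then obtain m where "(0, Suc m) \<notin> fst ` set h" by blast
    then show ?thesis by (intro exI[of _ "(0, Suc m)"]) simp
  qed
  then have "\<exists>e. ?legal h e \<and> ((\<exists>e. ?good h e) \<longrightarrow> ?good h e)" for h
    by (cases "\<exists>e. ?good h e") blast+
  from someI_ex[OF this] have "?legal h (\<beta> h) \<and> ((\<exists>e. ?good h e) \<longrightarrow> ?good h (\<beta> h))" for h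
    unfolding \<beta>_def .
  then have \<beta>: "?legal h (\<beta> h)" "(\<exists>e. ?good h e) \<Longrightarrow> ?good h (\<beta> h)" for h
    by blast+
  have "num_turns G H \<beta> \<pi> \<le> enat N" for \<pi>
  proof -
    \<comment> \<open>At \<open>t = N\<close> both alternatives say that the game is over.\<close>
    have "(\<exists>s\<le>t. game_over G H (play \<beta> \<pi> s)) \<or> ?win (N - t) (play \<beta> \<pi> t)" if "t \<le> N" for t
      using that
    proof (induction t)
      case 0
      then show ?case using assms by simp
    next
      case (Suc t)
      show ?case
      proof (cases "\<exists>s\<le>t. game_over G H (play \<beta> \<pi> s)")
        case True
        then show ?thesis by (meson le_SucI)
      next
        case False
        let ?h = "play \<beta> \<pi> t"
        have "?win (Suc (N - Suc t)) ?h" "\<not> game_over G H ?h"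
          using Suc False by (auto simp: Suc_diff_Suc)
        then have "\<exists>e. ?good ?h e" by simp
        from \<beta>(2)[OF this] show ?thesis by (simp add: Let_def)
      qed
    qed
    from this[of N] obtain s where "s \<le> N" "game_over G H (play \<beta> \<pi> s)" by auto
    then have "num_turns G H \<beta> \<pi> \<le> enat s"
      unfolding num_turns_def by (intro INF_lower) simp
    then show ?thesis using \<open>s \<le> N\<close> by (meson enat_ord_simps(1) order_trans)
  qed
  then have "(SUP \<pi>. num_turns G H \<beta> \<pi>) \<le> enat N" by (rule SUP_least)
  moreover have "legal_builder \<beta>" using \<beta>(1) by (simp add: legal_builder_def)
  ultimately show ?thesis
    unfolding online_ordered_ramsey_def by (intro INF_lower2[of \<beta>]) auto
qed

section \<open>Red matchings and blue paths as lists\<close>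

definition serial :: "edge list \<Rightarrow> bool" where
  "serial es \<longleftrightarrow> sorted_wrt (\<lambda>e e'. snd e < fst e') es \<and> (\<forall>e \<in> set es. fst e < snd e)"

lemma game_over_serial:
  assumes "serial es" "set es \<subseteq> coloured h Red" "k \<le> length es"
  shows "game_over (serial_matching k) H h"
proof -
  \<comment> \<open>Vertices \<open>2 * j\<close> and \<open>2 * j + 1\<close> of the matching go to
    the two ends of the edge \<open>es ! j\<close>.\<close>
  define f where "f i = (if even i then fst else snd) (es ! (i div 2))" for i
  have "f i < f j" if "i < j" "j < 2 * k" for i j
  proof (cases "i div 2 = j div 2")
    case True
    with that(1) have "even i \<and> odd j" by presburger
    then have "even i" "odd j" by simp_all
    moreover have "es ! (j div 2) \<in> set es" using that assms(3) by (intro nth_mem) simp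
    ultimately show ?thesis using assms(1) True by (simp add: f_def serial_def)
  next
    case False
    with that(1) have "i div 2 < j div 2" using div_le_mono[of i j 2] by simp
    moreover have "j div 2 < length es" using that assms(3) by simp
    ultimately have *: "snd (es ! (i div 2)) < fst (es ! (j div 2))"
      "es ! (i div 2) \<in> set es" "es ! (j div 2) \<in> set es"
      using assms(1) sorted_wrt_nth_less[of _ es "i div 2" "j div 2"]
      by (auto simp: serial_def)
    then have "fst (es ! (i div 2)) < snd (es ! (i div 2))"
      "fst (es ! (j div 2)) < snd (es ! (j div 2))"
      using assms(1) by (auto simp: serial_def)
    with *(1) show ?thesis by (simp add: f_def)
  qed
  then have "strict_mono_on {0..<2 * k} f" by (intro strict_mono_onI) auto
  moreover have "((f (2 * i), f (2 * i + 1)), Red) \<in> set h" if "i < k" for i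
  proof -
    have "es ! i \<in> coloured h Red" using that assms(2,3) by (metis less_le_trans nth_mem subsetD)
    then show ?thesis by (simp add: f_def mem_coloured)
  qed
  ultimately have "contains_copy (colour_graph h Red) (serial_matching k)"
    unfolding contains_copy_colour_graph[OF ordered_graph_matching]
    by (intro exI[of _ f]) (auto simp: serial_matching_def)
  then show ?thesis by (simp add: game_over_def)
qed

text \<open>
  A gap is free of used vertices and is large enough to be cut into three in each of the
  remaining \<open>t\<close> turns.
\<close>

definition gap :: "history \<Rightarrow> nat \<Rightarrow> nat \<Rightarrow> nat \<Rightarrow> bool" where
  "gap h t x y \<longleftrightarrow> x + 3 ^ t \<le> y \<and>
     (\<forall>e \<in> fst ` set h. fst e \<notin> {x<..<y} \<and> snd e \<notin> {x<..<y})"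

lemma gap_less: "gap h t x y \<Longrightarrow> x < y"
  by (auto simp: gap_def intro: less_le_trans[of x "x + 3 ^ t"])

lemma gap_fresh: "gap h t x y \<Longrightarrow> x < a \<Longrightarrow> a < y \<Longrightarrow> (a, b) \<notin> fst ` set h"
  unfolding gap_def by (metis fst_conv greaterThanLessThan_iff)

lemma gap_snoc:
  assumes "gap h t' x y" "x \<le> x'" "y' \<le> y" "x' + 3 ^ t \<le> y'"
    "a \<notin> {x'<..<y'}" "b \<notin> {x'<..<y'}"
  shows "gap (h @ [((a, b), c)]) t x' y'"
proof -
  have "{x'<..<y'} \<subseteq> {x<..<y}" using assms(2,3) by auto
  with assms(1) have "\<forall>e \<in> fst ` set h. fst e \<notin> {x'<..<y'} \<and> snd e \<notin> {x'<..<y'}"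
    unfolding gap_def by blast
  with assms(4-6) show ?thesis
    by (simp add: gap_def del: greaterThanLessThan_iff)
qed

text \<open>Gaps are kept between all consecutive vertices because giving up the first vertex makes
  Builder play just left of the second, and this may happen all along the path.\<close>

definition blue_path :: "history \<Rightarrow> nat \<Rightarrow> nat list \<Rightarrow> bool" where
  "blue_path h t = successively (\<lambda>x y. (x, y) \<in> coloured h Blue \<and> gap h t x y)"

lemma blue_path_simps [simp]:
  "blue_path h t []" "blue_path h t [x]"
  "blue_path h t (x # y # p) \<longleftrightarrow> (x, y) \<in> coloured h Blue \<and> gap h t x y \<and> blue_path h t (y # p)"
  by (auto simp: blue_path_def)

lemma blue_path_sorted: "blue_path h t p \<Longrightarrow> sorted_wrt (<) p"
proof (induction p rule: induct_list012)
  case (3 x y p)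
  then show ?case using gap_less[of h t x y] by auto
qed auto

lemma blue_path_hd_less_last: "blue_path h t p \<Longrightarrow> 2 \<le> length p \<Longrightarrow> hd p < last p"
  using blue_path_sorted[of h t p] by (cases p) auto

lemma blue_path_hd_le_last: "blue_path h t p \<Longrightarrow> p \<noteq> [] \<Longrightarrow> hd p \<le> last p"
  using blue_path_sorted[of h t p] by (cases p) (auto simp: less_imp_le)

text \<open>An edge with both ends on the same side of the path enters none of its gaps, so they
  only lose one turn of their budget.\<close>

lemma blue_path_snoc:
  assumes "blue_path h (Suc t) p" "p \<noteq> []"
    and "a \<le> hd p \<and> b \<le> hd p \<or> last p \<le> a \<and> last p \<le> b"
  shows "blue_path (h @ [((a, b), c)]) t p"
  using assms
proof (induction p rule: induct_list012)
  case (3 x y p)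
  have xy: "gap h (Suc t) x y" "(x, y) \<in> coloured h Blue" and p: "blue_path h (Suc t) (y # p)"
    using 3 by auto
  have "y \<le> last (y # p)" using blue_path_hd_le_last[OF p] by simp
  with 3 gap_less[OF xy(1)] have ab: "a \<le> x \<and> b \<le> x \<or> last (y # p) \<le> a \<and> last (y # p) \<le> b \<and> y \<le> a \<and> y \<le> b"
    by auto
  with gap_less[OF xy(1)] have "blue_path (h @ [((a, b), c)]) t (y # p)"
    by (intro "3.IH"(2)[OF p]) auto
  moreover have "gap (h @ [((a, b), c)]) t x y"
    using ab xy(1) by (intro gap_snoc[OF xy(1)]) (auto simp: gap_def)
  ultimately show ?case using xy(2) by (simp add: coloured_snoc)
qed auto

lemma game_over_path:
  assumes "blue_path h t p" "n \<le> length p"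
  shows "game_over G (ordered_path n) h"
proof -
  have "((p ! i, p ! Suc i), Blue) \<in> set h" if "Suc i < length p" for i
    using assms(1) that by (auto simp: blue_path_def successively_conv_nth mem_coloured)
  moreover have "strict_mono_on {0..<n} ((!) p)"
    using sorted_wrt_nth_less[OF blue_path_sorted[OF assms(1)]] assms(2)
    by (intro strict_mono_onI) auto
  ultimately have "contains_copy (colour_graph h Blue) (ordered_path n)"
    unfolding contains_copy_colour_graph[OF ordered_graph_path] using assms(2)
    by (intro exI[of _ "(!) p"]) (auto simp: ordered_path_def)
  then show ?thesis by (simp add: game_over_def)
qed

text \<open>The part \<open>l\<close> of the red matching lies to the left of the blue path, the part \<open>r\<close> to its right.\<close>

definition reds :: "history \<Rightarrow> edge list \<Rightarrow> edge list \<Rightarrow> nat \<Rightarrow> nat \<Rightarrow> bool" where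
  "reds h l r lo hi \<longleftrightarrow> serial l \<and> serial r \<and> set l \<union> set r \<subseteq> coloured h Red
     \<and> (\<forall>e \<in> set l. snd e \<le> lo) \<and> (\<forall>e \<in> set r. hi \<le> fst e)"

text \<open>The bounds in \<open>reds\<close> are weak, so that red edges may share an end with the
  blue path; \<open>lo < hi\<close> still separates \<open>l\<close> from \<open>r\<close>
  strictly.\<close>

lemma game_over_reds:
  assumes "reds h l r lo hi" "lo < hi" "k \<le> length l + length r"
  shows "game_over (serial_matching k) H h"
proof (rule game_over_serial)
  have "snd e < fst e'" if "e \<in> set l" "e' \<in> set r" for e e'
    using assms that by (fastforce simp: reds_def)
  then show "serial (l @ r)" using assms(1) by (auto simp: reds_def serial_def sorted_wrt_append)
qed (use assms in \<open>auto simp: reds_def\<close>)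

lemma reds_snoc:
  assumes "reds h l r lo hi" "lo \<le> lo'" "hi' \<le> hi"
  shows "reds (h @ [(e, c)]) l r lo' hi'"
  using assms unfolding reds_def by (auto simp: coloured_snoc dest: le_trans)

lemma reds_snoc_left:
  assumes "reds h l r lo hi" "lo < a" "a < b" "hi' \<le> hi"
  shows "reds (h @ [((a, b), Red)]) (l @ [(a, b)]) r b hi'"
proof -
  have "snd e < a \<and> snd e \<le> b" if "e \<in> set l" for e
    using assms that by (fastforce simp: reds_def)
  moreover have "hi' \<le> fst e" if "e \<in> set r" for e
    using assms(1,4) that le_trans by (auto simp: reds_def)
  ultimately show ?thesis
    using assms(1,3) by (simp add: reds_def coloured_snoc serial_def sorted_wrt_append subset_insertI2)
qed

text \<open>
  The inequalities bound the waste \<open>w\<close>, the number of edges drawn that are neither on the blue path \<open>p\<close>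
  nor in the red matching of size \<open>m = length l + length r\<close>: \<open>w = 0 = m\<close> initially, \<open>w \<le> m - 1\<close> when the path
  is empty or can still be extended to the left, and \<open>w \<le> m - 2\<close> when a red edge ends at its
  first vertex.
\<close>

inductive position :: "nat \<Rightarrow> history \<Rightarrow> bool" where
  initial: "position t h"
    if "Suc (length h) = length p" "blue_path h t p" "3 ^ t \<le> hd p"
      "\<forall>e \<in> fst ` set h. fst e \<in> {hd p..last p} \<and> snd e \<in> {hd p..last p}"
| empty: "position t h"
    if "length h + 1 \<le> 2 * (length l + length r)" "gap h t lo hi" "reds h l r lo hi"
| opened: "position t h"
    if "length h + 2 \<le> 2 * (length l + length r) + length p" "2 \<le> length p"
      "blue_path h t p" "gap h t lo (hd p)" "reds h l r lo (last p)"
| blocked: "position t h"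
    if "length h + 3 \<le> 2 * (length l + length r) + length p" "2 \<le> length p"
      "blue_path h t p" "reds h l r (hd p) (last p)"

section \<open>Turn counts and moves in Builder's positions\<close>

context
  fixes n k :: nat
  assumes n: "2 \<le> n" and k: "2 \<le> k"
begin

abbreviation over :: "history \<Rightarrow> bool" where
  "over \<equiv> game_over (serial_matching k) (ordered_path n)"

text \<open>In an unfinished game \<open>length p < n\<close> and
  \<open>length l + length r < k\<close>. The largest bound comes from \<open>opened\<close>:
  \<open>2 * (k - 1) + (n - 1) - 2 = n + 2 * k - 5\<close>.\<close>

lemma position_length:
  assumes "position t h" "\<not> over h"
  shows "length h < n + 2 * k - 4"
  using assms(1)
proof cases
  case (initial p)
  then have "length p < n" using game_over_path assms(2) by (meson not_le)
  then show ?thesis using initial k by simp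
next
  case (empty l r lo hi)
  then have "length l + length r < k"
    using game_over_reds gap_less assms(2) by (meson not_le)
  then show ?thesis using empty n by simp
next
  case (opened l r p lo)
  have "length p < n" using opened game_over_path assms(2) by (meson not_le)
  moreover have "lo < last p"
    using gap_less[OF opened(4)] blue_path_hd_less_last[OF opened(3,2)] by simp
  then have "length l + length r < k"
    using game_over_reds opened(5) assms(2) by (meson not_le)
  ultimately show ?thesis using opened(1,2) by simp
next
  case (blocked l r p)
  have "length p < n" using blocked game_over_path assms(2) by (meson not_le)
  moreover have "length l + length r < k"
    using game_over_reds blocked(4) blue_path_hd_less_last[OF blocked(3,2)] assms(2)
    by (meson not_le)
  ultimately show ?thesis using blocked(1,2) by simp
qed

text \<open>The new edge cuts the gap into three. A red one joins \<open>l\<close>, with the right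
  piece as the new gap; a blue one starts a path, with the left piece as room for extending
  it.\<close>

lemma position_step_empty:
  assumes len: "length h + 1 \<le> 2 * (length l + length r)"
    and gap: "gap h (Suc t) lo hi" and reds: "reds h l r lo hi"
  shows "\<exists>e. fst e < snd e \<and> e \<notin> fst ` set h \<and> (\<forall>c. position t (h @ [(e, c)]))"
proof -
  define y where "y = lo + 3 ^ t"
  define x where "x = y + 3 ^ t"
  have pos: "(0 :: nat) < 3 ^ t" by simp
  have "lo + 3 * 3 ^ t \<le> hi" using gap by (simp add: gap_def)
  with pos have yx: "lo < y" "y < x" "x < hi" "x + 3 ^ t \<le> hi"
    unfolding x_def y_def by linarith+
  have "position t (h @ [((y, x), c)])" for c
  proof (cases c)
    case Red
    have "gap (h @ [((y, x), Red)]) t x hi"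
      using yx by (intro gap_snoc[OF gap]) auto
    moreover have "reds (h @ [((y, x), Red)]) (l @ [(y, x)]) r x hi"
      using yx by (intro reds_snoc_left[OF reds]) auto
    ultimately show ?thesis unfolding Red using len by (intro position.empty) auto
  next
    case Blue
    let ?h = "h @ [((y, x), Blue)]"
    have "gap ?h t lo y" using yx by (intro gap_snoc[OF gap]) (auto simp: y_def)
    moreover have "gap ?h t y x" using yx by (intro gap_snoc[OF gap]) (auto simp: x_def)
    moreover have "reds ?h l r lo x" using yx by (intro reds_snoc[OF reds]) auto
    ultimately show ?thesis unfolding Blue using len
      by (intro position.opened[where p = "[y, x]"]) (auto simp: coloured_snoc)
  qed
  moreover have "(y, x) \<notin> fst ` set h" using gap_fresh[OF gap] yx by simp
  ultimately show ?thesis using yx by (intro exI[of _ "(y, x)"]) simp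
qed

text \<open>A turn adds 1 to \<open>length h\<close>, while a red answer adds 2 for the larger
  matching. The surplus pays for the edge lost when the first vertex of a blocked path is given
  up.\<close>

lemma position_step:
  assumes "position (Suc t) h"
  shows "\<exists>e. fst e < snd e \<and> e \<notin> fst ` set h \<and> (\<forall>c. position t (h @ [(e, c)]))"
  using assms
proof cases
  case (initial p)
  have pos: "(0 :: nat) < 3 ^ t" by simp
  have "p \<noteq> []" using initial by auto
  note le = blue_path_hd_le_last[OF initial(2) this]
  define v where "v = last p + 3 ^ t"
  have v: "last p < v" using pos by (simp add: v_def)
  have used: "fst e \<in> {hd p..last p} \<and> (snd e \<in> {hd p..last p} \<or> snd e = v)"
    if e: "e \<in> fst ` set (h @ [((last p, v), c)])" for e c
  proof (cases "e = (last p, v)")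
    case True
    then show ?thesis using le by simp
  next
    case False
    with e have "e \<in> fst ` set h" by auto
    then show ?thesis using initial(4) by blast
  qed
  have "position t (h @ [((last p, v), c)])" for c
  proof (cases c)
    case Red
    let ?h = "h @ [((last p, v), Red)]"
    have "fst e \<notin> {0<..<hd p} \<and> snd e \<notin> {0<..<hd p}" if "e \<in> fst ` set ?h" for e
      using used[OF that] le v by auto
    then have "gap ?h t 0 (hd p)" using initial(3) by (simp add: gap_def)
    moreover have "reds ?h [] [(last p, v)] 0 (last p)"
      using v by (simp add: reds_def serial_def coloured_snoc)
    moreover have "blue_path ?h t p"
      using v by (intro blue_path_snoc[OF initial(2) \<open>p \<noteq> []\<close>]) auto
    \<comment> \<open>With no blue edge drawn the result is of kind \<open>empty\<close>; its
      \<open>hi\<close> bounds the gap as \<open>hd p\<close> and the red edge as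
      \<open>last p\<close>.\<close>
    moreover have "hd p = last p" if "length p < 2"
      using that \<open>p \<noteq> []\<close> by (cases p) auto
    ultimately show ?thesis unfolding Red using initial(1)
      by (cases "length p < 2")
        (auto intro: position.empty[where l = "[]" and r = "[(last p, v)]"]
          position.opened[where l = "[]" and r = "[(last p, v)]"])
  next
    case Blue
    let ?h = "h @ [((last p, v), Blue)]"
    have "blue_path ?h t p"
      using v by (intro blue_path_snoc[OF initial(2) \<open>p \<noteq> []\<close>]) auto
    moreover have "fst e \<notin> {last p<..<v} \<and> snd e \<notin> {last p<..<v}" if "e \<in> fst ` set ?h" for e
      using used[OF that] v by auto
    then have "gap ?h t (last p) v" by (simp add: gap_def v_def)
    ultimately have "blue_path ?h t (p @ [v])"
      using \<open>p \<noteq> []\<close> by (auto simp: blue_path_def successively_append_iff coloured_snoc)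
    moreover have "fst e \<in> {hd p..v} \<and> snd e \<in> {hd p..v}" if "e \<in> fst ` set ?h" for e
      using used[OF that] le v by auto
    ultimately show ?thesis unfolding Blue using initial(1,3) \<open>p \<noteq> []\<close>
      by (intro position.initial[where p = "p @ [v]"]) auto
  qed
  moreover have "(last p, v) \<notin> fst ` set h" using initial(4) v by auto
  ultimately show ?thesis using v by (intro exI[of _ "(last p, v)"]) simp
next
  case (empty l r lo hi)
  then show ?thesis by (rule position_step_empty)
next
  case (opened l r p lo)
  have pos: "(0 :: nat) < 3 ^ t" by simp
  have ne: "p \<noteq> []" using opened by auto
  define y where "y = lo + 3 ^ t"
  have "lo + 3 * 3 ^ t \<le> hd p" using opened(4) by (simp add: gap_def)
  with pos have y: "lo < y" "y < hd p" "y + 3 ^ t \<le> hd p"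
    unfolding y_def by linarith+
  have "position t (h @ [((y, hd p), c)])" for c
  proof (cases c)
    case Red
    let ?h = "h @ [((y, hd p), Red)]"
    have "blue_path ?h t p" using y ne by (intro blue_path_snoc[OF opened(3)]) auto
    moreover have "reds ?h (l @ [(y, hd p)]) r (hd p) (last p)"
      using y by (intro reds_snoc_left[OF opened(5)]) auto
    ultimately show ?thesis unfolding Red using opened(1,2)
      by (intro position.blocked[where p = p and l = "l @ [(y, hd p)]" and r = r]) auto
  next
    case Blue
    let ?h = "h @ [((y, hd p), Blue)]"
    have "blue_path ?h t p" using y ne by (intro blue_path_snoc[OF opened(3)]) auto
    moreover have "gap ?h t y (hd p)" using y by (intro gap_snoc[OF opened(4)]) auto
    ultimately have "blue_path ?h t (y # p)" using ne by (cases p) (auto simp: coloured_snoc)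
    moreover have "gap ?h t lo y" using y by (intro gap_snoc[OF opened(4)]) (auto simp: y_def)
    moreover have "reds ?h l r lo (last p)" by (intro reds_snoc[OF opened(5)]) auto
    ultimately show ?thesis unfolding Blue using opened(1,2) ne
      by (intro position.opened[where p = "y # p" and l = l and r = r and lo = lo]) auto
  qed
  moreover have "(y, hd p) \<notin> fst ` set h" using gap_fresh[OF opened(4)] y by simp
  ultimately show ?thesis using y by (intro exI[of _ "(y, hd p)"]) simp
next
  case (blocked l r p)
  then obtain s s' q where p: "p = s # s' # q"
    by (cases p; cases "tl p") auto
  have gap: "gap h (Suc t) s s'" and q: "blue_path h (Suc t) (s' # q)"
    using blocked(3) p by auto
  show ?thesis
  proof (cases "q = []")
    case True
    \<comment> \<open>The path is the single edge from \<open>s\<close> to \<open>s'\<close>.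
      Dropping it leaves an empty position in the gap between them: a path of length 2 turns the
      blocked bound into the empty one.\<close>
    then show ?thesis using blocked p gap by (intro position_step_empty) auto
  next
    case False
    then have len: "2 \<le> length (s' # q)" by (cases q) auto
    have pos: "(0 :: nat) < 3 ^ t" by simp
    have last: "last p = last (s' # q)" by (simp add: p)
    have reds: "reds h l r s (last (s' # q))" using blocked(4) by (simp add: p)
    define y where "y = s + 3 ^ t"
    have "s + 3 * 3 ^ t \<le> s'" using gap by (simp add: gap_def)
    with pos have y: "s < y" "y < s'" "y + 3 ^ t \<le> s'"
      unfolding y_def by linarith+
    \<comment> \<open>The edge from \<open>s\<close> to \<open>s'\<close> is given up. After red,
      the path is one vertex shorter but the matching gains an edge, so the bound with 3 persists;
      after blue, the path keeps its length and only the bound with 2 is needed.\<close>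
    have "position t (h @ [((y, s'), c)])" for c
    proof (cases c)
      case Red
      let ?h = "h @ [((y, s'), Red)]"
      have "blue_path ?h t (s' # q)" using y by (intro blue_path_snoc[OF q]) auto
      moreover have "reds ?h (l @ [(y, s')]) r s' (last (s' # q))"
        using y by (intro reds_snoc_left[OF reds]) auto
      ultimately show ?thesis unfolding Red using blocked(1) len p
        by (intro position.blocked[where p = "s' # q" and l = "l @ [(y, s')]" and r = r]) auto
    next
      case Blue
      let ?h = "h @ [((y, s'), Blue)]"
      have "blue_path ?h t (s' # q)" using y by (intro blue_path_snoc[OF q]) auto
      moreover have "gap ?h t y s'" using y by (intro gap_snoc[OF gap]) auto
      ultimately have "blue_path ?h t (y # s' # q)" by (simp add: coloured_snoc)
      moreover have "gap ?h t s y" using y by (intro gap_snoc[OF gap]) (auto simp: y_def)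
      moreover have "reds ?h l r s (last (s' # q))" by (intro reds_snoc[OF reds]) auto
      ultimately show ?thesis unfolding Blue using blocked(1) p
        by (intro position.opened[where p = "y # s' # q" and l = l and r = r and lo = s]) auto
    qed
    moreover have "(y, s') \<notin> fst ` set h" using gap_fresh[OF gap] y by simp
    ultimately show ?thesis using y by (intro exI[of _ "(y, s')"]) simp
  qed
qed

lemma position_wins:
  assumes "position t h" "length h + t = n + 2 * k - 4"
  shows "builder_wins over t h"
  using assms
proof (induction t arbitrary: h)
  case 0
  then show ?case using position_length[of 0 h] by auto
next
  case (Suc t)
  obtain e where e: "fst e < snd e" "e \<notin> fst ` set h" "\<And>c. position t (h @ [(e, c)])"
    using position_step[OF Suc.prems(1)] by blast
  have "builder_wins over t (h @ [(e, c)])" for c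
    using Suc.prems(2) by (intro Suc.IH[OF e(3)]) simp
  with e(1,2) show ?case unfolding builder_wins.simps by blast
qed

lemma ramsey_matching_path_le:
  "online_ordered_ramsey (serial_matching k) (ordered_path n) \<le> enat (n + 2 * k - 4)"
proof (intro ramsey_le position_wins)
  show "position (n + 2 * k - 4) []"
    \<comment> \<open>Vertices are numbered from 0, so starting at a large vertex reserves the room
      for all later moves to the left.\<close>
    by (rule position.initial[where p = "[3 ^ (n + 2 * k - 4)]"]) auto
qed simp

end

theorem theorem1p3:
  fixes n k :: nat
  assumes "n \<ge> 4" and "k \<ge> 2"
  shows "online_ordered_ramsey (serial_matching k) (ordered_path n) \<le> enat (n + 2 * k - 4)
    \<and> (n \<ge> 3 * k - 3 \<longrightarrow>
        online_ordered_ramsey (serial_matching k) (ordered_path n) = enat (n + 2 * k - 4))"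
proof (intro conjI impI antisym)
  show "enat (n + 2 * k - 4) \<le> online_ordered_ramsey (serial_matching k) (ordered_path n)"
    if "n \<ge> 3 * k - 3"
    using assms that by (intro ramsey_ge) auto
qed (use assms in \<open>simp_all add: ramsey_matching_path_le\<close>)

end
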